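(* Let $p(x)=\sum_{i=0}^m d_ix^i$ be a skew-palindromic polynomial of degree $m=2m'+1$ over a field $F$ of characteristic zero, and let $d_{k,n}$ denote the entries of its binomial array $B(d_i)$. For $t\ge1$ let $D_t:=d_{m'+t,\,2t}$. Then for all $t\ge1$, $$D_t=\sum_{i=0}^{m'}d_i\,c_{m-2i}(t),$$ where for $j\ge0$, $c_{2j+1}(t)$ denotes the coefficient of $x^{j+t}$ in $(1+x)^{2t}(1-x^{2j+1})$ (explicitly, $c_1(t)=C_t=\frac{1}{t+1}\binom{2t}{t}$ and $c_{2j+1}(t)=\frac{2j+1}{t+j+1}\binom{2t}{t-j}$).
   Context: A polynomial of degree $m$ is skew-palindromic if $p(x)=-x^mp(1/x)$, i.e. $d_i=-d_{m-i}$. The binomial array $B(d_i)$ has entries $d_{k,n}$ equal to the coefficient of $x^k$ in $(1+x)^np(x)$. The entries $d_{m'+t,2t-1}$ are zero, and $D_t$ is the near-zero sequence to their right; $c_{2j+1}(t)$ is the entry in row $j+t$, column $2t$ of the binomial array $B(1-x^{2j+1})$. *)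

theory Defs
  imports Complex_Main "HOL-Computational_Algebra.Polynomial"
begin

text \<open>Coefficientwise form of \<open>p(x) = - x\<^sup>m p(1/x)\<close> with \<open>m = degree p\<close>, the exact degree.\<close>

definition skew_palindromic :: "'a::comm_ring_1 poly \<Rightarrow> bool" where
  "skew_palindromic p \<longleftrightarrow>
     (\<forall>i\<le>degree p. poly.coeff p i = - poly.coeff p (degree p - i))"

text \<open>\<open>[:1, 1:]\<close> is \<open>1 + x\<close>; the row index \<open>k\<close> comes before the column index \<open>n\<close>.\<close>

definition binomial_array :: "'a::comm_ring_1 poly \<Rightarrow> nat \<Rightarrow> nat \<Rightarrow> 'a" where
  "binomial_array p k n = poly.coeff ([:1, 1:] ^ n * p) k"

text \<open>The sequence \<open>D\<^sub>t\<close>, meant for \<open>degree p = 2 m' + 1\<close>, so that \<open>degree p div 2 = m'\<close>.\<close>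

definition near_zero_seq :: "'a::comm_ring_1 poly \<Rightarrow> nat \<Rightarrow> 'a" where
  "near_zero_seq p t = binomial_array p (degree p div 2 + t) (2 * t)"

text \<open>
  The argument \<open>l\<close> is the subscript of \<open>c\<close> and is meant to be odd:
  for \<open>l = 2 j + 1\<close> we have \<open>l div 2 = j\<close>.
\<close>

definition catalan_coeff :: "nat \<Rightarrow> nat \<Rightarrow> 'a::comm_ring_1" where
  "catalan_coeff l t = binomial_array (1 - monom 1 l) (l div 2 + t) (2 * t)"

lemma catalan_coeff_odd:
  "catalan_coeff (2 * j + 1) t =
     poly.coeff ([:1, 1:] ^ (2 * t) * (1 - monom 1 (2 * j + 1))) (j + t)"
  by (simp add: catalan_coeff_def binomial_array_def)

end

theory Submission
  imports Defs
begin

text \<open>Skew-palindromicity pairs the terms at \<open>i\<close> and \<open>m - i\<close> into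
  d_i x^i (1 - x^(m-2i)), and since m is odd these pairs exhaust p
  (\<open>skew_palindromic_as_sum\<close>). Multiply by (1+x)^(2t) and read off the coefficient at
  m'+t: the factor x^i lowers the index to (m'-i)+t, which is the index defining c_(m-2i)(t)
  (\<open>near_zero_seq_skew_palindromic\<close>). The explicit values are ballot numbers:
  c_(2j+1)(t) is a difference of two binomials which symmetry makes adjacent, and their ratio is
  known (\<open>catalan_coeff_odd_closed_form\<close>).\<close>

lemma coeff_one_plus_X_power:
  "poly.coeff ([:1, 1:] ^ n) k = (of_nat (n choose k) :: 'a::comm_ring_1)"
proof (induction n arbitrary: k)
  case 0
  then show ?case by (cases k) simp_all
next
  case (Suc n)
  then show ?case by (cases k) (simp_all add: add.commute)
qed

text \<open>Multiplication by x^(2j+1) shifts the coefficient index. The guard \<open>j < t\<close>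
  is needed because truncated subtraction would otherwise turn the absent term into
  \<open>(2 * t) choose 0\<close>, which is 1.\<close>

lemma catalan_coeff_odd_eq:
  "catalan_coeff (2 * j + 1) t = (of_nat ((2 * t) choose (t + j)) -
     (if j < t then of_nat ((2 * t) choose (t - j - 1)) else 0) :: 'a::comm_ring_1)"
proof -
  have "j + t - (2 * j + 1) = t - j - 1" "2 * j + 1 \<le> j + t \<longleftrightarrow> j < t"
    by auto
  then show ?thesis
    unfolding catalan_coeff_odd right_diff_distrib mult.commute[of _ "monom _ _"]
    by (simp add: coeff_monom_mult coeff_one_plus_X_power add.commute not_le[symmetric])
qed

lemma catalan_coeff_odd_closed_form:
  "(catalan_coeff (2 * j + 1) t :: 'a::field_char_0) =
     of_nat (2 * j + 1) / of_nat (t + j + 1) *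
       (if j \<le> t then of_nat ((2 * t) choose (t - j)) else 0)"
proof (cases "j < t")
  case True
  define k where "k = t - j - 1"
  have t: "t = j + k + 1" using True by (simp add: k_def)
  define b where "b = (of_nat ((2 * t) choose (k + 1)) :: 'a)"
  have sym: "(2 * t) choose (t + j) = (2 * t) choose (k + 1)"
    by (subst binomial_symmetric) (simp_all add: t)
  \<comment> \<open>By the two absorption identities both sides equal
    \<open>2 * t * ((2 * t - 1) choose k)\<close>.\<close>
  have "(k + 1) * ((2 * t) choose (k + 1)) = (t + j + 1) * ((2 * t) choose k)"
  proof -
    have "2 * t - k = t + j + 1" by (simp add: t)
    then show ?thesis
      using binomial_absorb_comp[of "2 * t" k] binomial_absorption[of k "2 * t"]
      by (simp only: Suc_eq_plus1)
  qed
  then have "of_nat (k + 1) * b = of_nat (t + j + 1) * (of_nat ((2 * t) choose k) :: 'a)"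
    unfolding b_def by (metis of_nat_mult)
  then have "(of_nat ((2 * t) choose k) :: 'a) = of_nat (k + 1) / of_nat (t + j + 1) * b"
    by (simp add: field_simps del: of_nat_add of_nat_Suc)
  \<comment> \<open>This gives the numerator: 1 - (k+1)/(t+j+1) = (2j+1)/(t+j+1).\<close>
  moreover have "(of_nat (t + j + 1) :: 'a) = of_nat (k + 1) + of_nat (2 * j + 1)"
    unfolding of_nat_add[symmetric] by (simp add: t)
  moreover have "(of_nat (t + j + 1) :: 'a) \<noteq> 0"
    by (simp del: of_nat_add of_nat_Suc)
  ultimately have "b - of_nat ((2 * t) choose k) = of_nat (2 * j + 1) / of_nat (t + j + 1) * b"
    by (simp add: field_simps del: of_nat_add of_nat_Suc of_nat_mult)
  moreover have "t - j = k + 1" "t - j - 1 = k" by (simp_all add: t)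
  ultimately show ?thesis
    using True by (simp only: catalan_coeff_odd_eq sym b_def if_True less_imp_le)
next
  case False
  \<comment> \<open>For \<open>t < j\<close> both sides vanish; for \<open>t = j\<close> both are
    1.\<close>
  then have "t < j \<or> t = j" by auto
  then show ?thesis
    by (elim disjE) (simp_all only: catalan_coeff_odd_eq,
      simp_all add: binomial_eq_0 mult_2 flip: of_nat_add of_nat_Suc)
qed

lemma skew_palindromic_as_sum:
  fixes p :: "'a::comm_ring_1 poly"
  assumes "degree p = 2 * r + 1" and "skew_palindromic p"
  shows "p = (\<Sum>i\<le>r. monom (poly.coeff p i) i * (1 - monom 1 (degree p - 2 * i)))"
proof -
  let ?d = "poly.coeff p" and ?m = "degree p"
  have "p = (\<Sum>i\<le>?m. monom (?d i) i)"
    by (simp add: poly_as_sum_of_monoms)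
  \<comment> \<open>The degree is odd, so no index is fixed by the reflection i -> m - i, and the
    upper half is the disjoint mirror image of the lower half.\<close>
  also have "{..?m} = {..r} \<union> (\<lambda>i. ?m - i) ` {..r}"
  proof (intro equalityI subsetI)
    fix k assume k: "k \<in> {..?m}"
    show "k \<in> {..r} \<union> (\<lambda>i. ?m - i) ` {..r}"
    proof (cases "k \<le> r")
      case False
      then show ?thesis
        using k assms(1) by (intro UnI2 image_eqI[of _ _ "?m - k"]) auto
    qed auto
  qed (use assms(1) in auto)
  also have "(\<Sum>i\<in>\<dots>. monom (?d i) i) =
      (\<Sum>i\<le>r. monom (?d i) i) + (\<Sum>i\<in>(\<lambda>i. ?m - i) ` {..r}. monom (?d i) i)"
    by (rule sum.union_disjoint) (use assms(1) in auto)
  also have "(\<Sum>i\<in>(\<lambda>i. ?m - i) ` {..r}. monom (?d i) i) = (\<Sum>i\<le>r. monom (?d (?m - i)) (?m - i))"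
    by (subst sum.reindex) (use assms(1) in \<open>auto simp: inj_on_def\<close>)
  also have "(\<Sum>i\<le>r. monom (?d i) i) + \<dots> =
      (\<Sum>i\<le>r. monom (?d i) i * (1 - monom 1 (?m - 2 * i)))"
    unfolding sum.distrib[symmetric]
  proof (rule sum.cong)
    fix i assume "i \<in> {..r}"
    then have i: "i \<le> ?m" "i + (?m - 2 * i) = ?m - i"
      using assms(1) by auto
    then have "?d i = - ?d (?m - i)"
      using assms(2) unfolding skew_palindromic_def by blast
    then have "?d (?m - i) = - ?d i"
      by (metis minus_minus)
    with i(2) show "monom (?d i) i + monom (?d (?m - i)) (?m - i) =
        monom (?d i) i * (1 - monom 1 (?m - 2 * i))"
      by (simp add: right_diff_distrib mult_monom flip: minus_monom)
  qed simp
  finally show ?thesis .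
qed

lemma near_zero_seq_skew_palindromic:
  fixes p :: "'a::comm_ring_1 poly"
  assumes "degree p = 2 * r + 1" and "skew_palindromic p"
  shows "near_zero_seq p t = (\<Sum>i\<le>r. poly.coeff p i * catalan_coeff (degree p - 2 * i) t)"
proof -
  let ?q = "\<lambda>i. [:1, 1:] ^ (2 * t) * (1 - monom 1 (degree p - 2 * i)) :: 'a poly"
  have "near_zero_seq p t = poly.coeff ([:1, 1:] ^ (2 * t) * p) (r + t)"
    by (simp add: near_zero_seq_def binomial_array_def assms(1))
  \<comment> \<open>The decomposition is applied under the multiplication, so that only the factor
    \<open>p\<close> is expanded and not its occurrences in \<open>poly.coeff p i\<close> and
    \<open>degree p\<close>.\<close>
  also have "[:1, 1:] ^ (2 * t) * p = (\<Sum>i\<le>r. monom (poly.coeff p i) i * ?q i)"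
    by (subst arg_cong[OF skew_palindromic_as_sum[OF assms], of "(*) ([:1, 1:] ^ (2 * t))"])
      (simp add: sum_distrib_left mult.left_commute)
  also have "poly.coeff \<dots> (r + t) = (\<Sum>i\<le>r. poly.coeff p i * poly.coeff (?q i) (r - i + t))"
    unfolding coeff_sum
    by (rule sum.cong) (auto simp: coeff_monom_mult simp del: mult_1_left)
  also have "\<dots> = (\<Sum>i\<le>r. poly.coeff p i * catalan_coeff (degree p - 2 * i) t)"
  proof (rule sum.cong)
    fix i assume "i \<in> {..r}"
    \<comment> \<open>Hence the row \<open>r - i + t\<close> is the one that
      \<open>catalan_coeff\<close> uses for the subscript \<open>degree p - 2 * i\<close>.\<close>
    then have "(degree p - 2 * i) div 2 = r - i" using assms(1) by auto
    then show "poly.coeff p i * poly.coeff (?q i) (r - i + t) =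
        poly.coeff p i * catalan_coeff (degree p - 2 * i) t"
      by (simp only: catalan_coeff_def binomial_array_def)
  qed simp
  finally show ?thesis .
qed

theorem theorem8p11:
  fixes p :: "'a::field_char_0 poly" and m m' :: nat
  assumes "m = 2 * m' + 1"
    and "degree p = m"
    and "skew_palindromic p"
  shows "(\<forall>t\<ge>1. near_zero_seq p t =
           (\<Sum>i=0..m'. poly.coeff p i * catalan_coeff (m - 2 * i) t)) \<and>
         (\<forall>t\<ge>1. (catalan_coeff 1 t :: 'a) =
           1 / of_nat (t + 1) * of_nat ((2 * t) choose t)) \<and>
         (\<forall>j. \<forall>t\<ge>1. (catalan_coeff (2 * j + 1) t :: 'a) =
           of_nat (2 * j + 1) / of_nat (t + j + 1) *
             (if j \<le> t then of_nat ((2 * t) choose (t - j)) else 0))"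
proof (intro conjI allI impI)
  fix t :: nat
  show "near_zero_seq p t = (\<Sum>i=0..m'. poly.coeff p i * catalan_coeff (m - 2 * i) t)"
    using near_zero_seq_skew_palindromic[of p m' t] assms by (simp add: atLeast0AtMost)
  show "(catalan_coeff 1 t :: 'a) = 1 / of_nat (t + 1) * of_nat ((2 * t) choose t)"
    using catalan_coeff_odd_closed_form[of 0 t, where 'a = 'a] by simp
qed (rule catalan_coeff_odd_closed_form)

end
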